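(* Let $q$ be a prime power, let $n,k$ be positive integers with $n\geq 2k$, and let $S$ be a subset of $\{0,1,\dots,k-1\}$ with $\emptyset\neq S\neq\{0,1,\dots,k-1\}$. Put $s:=\min(S)$. Then the generalized Grassmann graph $J_{q,S}(n,k)$ has diameter \[\operatorname{diam}\left(J_{q,S}(n,k)\right)=\begin{cases}2&\text{if }s=0,\\ \left\lceil\frac{k}{k-s}\right\rceil&\text{if }s\neq0.\end{cases}\]
   Context: For a prime power $q$, $\mathbb{F}_q$ denotes the finite field of order $q$, and a $k$-subspace means a $k$-dimensional subspace of $\mathbb{F}_q^n$. For $S\subseteq\{0,1,\dots,k-1\}$, the generalized Grassmann graph $J_{q,S}(n,k)$ is the simple graph whose vertices are the $k$-subspaces of $\mathbb{F}_q^n$, two distinct vertices being adjacent if and only if the dimension of their intersection lies in $S$. The diameter is the largest distance (length of a shortest walk) between two vertices. *)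

theory Defs
  imports
    "HOL-Analysis.Cartesian_Space"
    "HOL-Library.Extended_Nat"
    "HOL-Number_Theory.Prime_Powers"
    "Graph_Theory.Pair_Digraph"
begin

text \<open>Distances are extended naturals: the infimum over an empty set of walks is \<^term>\<open>\<infinity> :: enat\<close>,
  so vertices in different components are at infinite distance. A nonempty set of extended naturals
  attains its infimum, and attains its supremum when the latter is finite.\<close>

definition graph_dist :: "('v, 'e) pre_digraph \<Rightarrow> 'v \<Rightarrow> 'v \<Rightarrow> enat" where
  "graph_dist G u v = (INF p \<in> {p. pre_digraph.awalk G u p v}. enat (length p))"

definition graph_diameter :: "('v, 'e) pre_digraph \<Rightarrow> enat" where
  "graph_diameter G = (SUP u \<in> verts G. SUP v \<in> verts G. graph_dist G u v)"

definition k_subspaces :: "nat \<Rightarrow> ('a::field ^ 'n) set set" where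
  "k_subspaces k = {V. vec.subspace V \<and> vec.dim V = k}"

text \<open>The field and the dimension of the ambient space are carried by the types \<open>'a\<close> and \<open>'n\<close>.
  As usual for \<^type>\<open>pair_pre_digraph\<close>, an undirected edge is a pair of opposite arcs.\<close>

definition gen_grassmann_graph :: "nat set \<Rightarrow> nat \<Rightarrow> ('a::field ^ 'n) set pair_pre_digraph" where
  "gen_grassmann_graph S k =
     \<lparr> pverts = k_subspaces k,
       parcs = {(U, V). U \<in> k_subspaces k \<and> V \<in> k_subspaces k \<and> U \<noteq> V \<and> vec.dim (U \<inter> V) \<in> S} \<rparr>"

lemma pair_graph_gen_grassmann_graph:
  "pair_graph (gen_grassmann_graph S k :: ('a::{field,finite} ^ 'n) set pair_pre_digraph)"
proof -
  have "finite (UNIV :: ('a ^ 'n) set)"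
    by simp
  then have fin: "finite A" for A :: "('a ^ 'n) set set"
    by (metis Finite_Set.finite_set finite_subset top_greatest)
  have fin2: "finite A" for A :: "(('a ^ 'n) set \<times> ('a ^ 'n) set) set"
    by (rule finite_subset[of A "UNIV \<times> UNIV"]) (auto intro: fin finite_cartesian_product)
  show ?thesis
    by unfold_locales
      (auto simp: gen_grassmann_graph_def symmetric_def Int_commute intro!: symI fin fin2)
qed

end

theory Submission
  imports Defs
begin

text \<open>Put \<open>t = k - s\<close> and call \<open>k - dim (U \<inter> V)\<close> the separation of two \<open>k\<close>-subspaces. It satisfies the
  triangle inequality and is at most \<open>t\<close> along an edge, so a pair with trivial intersection (which
  exists as \<open>n \<ge> 2 * k\<close>) has distance at least \<open>k / t\<close>; for \<open>s = 0\<close>, any pair with intersection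
  dimension in \<open>{0..<k} - S\<close> has distance at least 2. Conversely, edges with intersection of dimension
  exactly \<open>s\<close> already suffice: subspaces of separation at most \<open>2 * t\<close> have a common neighbour, and
  if the separation is larger, then one step decreases it by \<open>t\<close>.\<close>

section \<open>Dimensions of intersections of subspaces\<close>

context finite_dimensional_vector_space
begin

lemma span_Un_span: "span (span A \<union> span B) = span (A \<union> B)"
  by (simp add: span_Un span_span)

lemma dim_Un_add_dim_Int:
  assumes "subspace U" "subspace V"
  shows "dim (U \<union> V) + dim (U \<inter> V) = dim U + dim V"
proof -
  have "span (U \<union> V) = {x + y |x y. x \<in> U \<and> y \<in> V}"
    using assms by (simp add: span_Un span_eq_iff[THEN iffD2])
  then have "dim (U \<union> V) = dim {x + y |x y. x \<in> U \<and> y \<in> V}"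
    by (metis dim_span)
  then show ?thesis
    using dim_sums_Int[OF assms] by simp
qed

text \<open>\<open>U \<inter> V\<close> and \<open>V \<inter> W\<close> both lie in
  \<open>V\<close>, hence so does their sum, and their intersection lies in
  \<open>U \<inter> W\<close>; the dimension formula does the rest.\<close>

lemma dim_Int_triangle:
  assumes "subspace U" "subspace V" "subspace W"
  shows "dim (U \<inter> V) + dim (V \<inter> W) \<le> dim V + dim (U \<inter> W)"
proof -
  have "dim (U \<inter> V \<union> V \<inter> W) + dim ((U \<inter> V) \<inter> (V \<inter> W)) = dim (U \<inter> V) + dim (V \<inter> W)"
    by (intro dim_Un_add_dim_Int subspace_inter assms)
  moreover have "dim (U \<inter> V \<union> V \<inter> W) \<le> dim V"
    by (intro dim_subset) auto
  moreover have "dim ((U \<inter> V) \<inter> (V \<inter> W)) \<le> dim (U \<inter> W)"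
    by (intro dim_subset) auto
  ultimately show ?thesis
    by linarith
qed

text \<open>A basis \<open>W\<close> of \<open>U \<inter> V\<close> is extended to bases
  \<open>C\<close> of \<open>U\<close> and \<open>D\<close> of \<open>V\<close>. By the dimension
  formula \<open>C \<union> D\<close> has as many elements as the dimension of \<open>U + V\<close>,
  so it is independent and extends to a basis of the whole space.\<close>

lemma exists_basis_adapted_to_pair:
  assumes U: "subspace U" and V: "subspace V"
  obtains W X Y E where "independent (W \<union> X \<union> Y \<union> E)"
    "W \<inter> X = {}" "W \<inter> Y = {}" "X \<inter> Y = {}" "(W \<union> X \<union> Y) \<inter> E = {}"
    "U = span (W \<union> X)" "V = span (W \<union> Y)"
    "card W = dim (U \<inter> V)" "card (W \<union> X \<union> Y \<union> E) = dim UNIV"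
proof -
  obtain W where W: "W \<subseteq> U \<inter> V" "independent W" "U \<inter> V \<subseteq> span W" "card W = dim (U \<inter> V)"
    using basis_exists by metis
  obtain C where C: "W \<subseteq> C" "C \<subseteq> U" "independent C" "U \<subseteq> span C"
    using maximal_independent_subset_extend[of W U] W by auto
  obtain D where D: "W \<subseteq> D" "D \<subseteq> V" "independent D" "V \<subseteq> span D"
    using maximal_independent_subset_extend[of W V] W by auto
  have fin: "finite C" "finite D" "finite W"
    using C(3) D(3) W(2) finiteI_independent by auto
  have spC: "span C = U"
    using C U by (simp add: span_minimal subset_antisym)
  have spD: "span D = V"
    using D V by (simp add: span_minimal subset_antisym)
  have cC: "card C = dim U"
    using C basis_card_eq_dim by blast
  have cD: "card D = dim V"
    using D basis_card_eq_dim by blast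
  \<comment> \<open>A further common vector would lie in \<open>U \<inter> V\<close>, hence in
    \<open>span W\<close>, against the independence of \<open>C\<close>.\<close>
  have CD: "C \<inter> D = W"
  proof (rule ccontr)
    assume "C \<inter> D \<noteq> W"
    then obtain v where v: "v \<in> C" "v \<in> D" "v \<notin> W"
      using C(1) D(1) by blast
    then have "v \<in> span W"
      using C(2) D(2) W(3) by blast
    moreover have "span W \<subseteq> span (C - {v})"
      using C(1) v by (intro span_mono) auto
    ultimately show False
      using C(3) v(1) by (auto simp: dependent_def)
  qed
  have "card (C \<union> D) + card W = dim U + dim V"
    using card_Un_Int[OF fin(1,2)] CD cC cD by simp
  then have "card (C \<union> D) = dim (U \<union> V)"
    using dim_Un_add_dim_Int[OF U V] W(4) by linarith
  moreover have "U \<union> V \<subseteq> span (C \<union> D)"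
    using C(4) D(4) span_mono[of C "C \<union> D"] span_mono[of D "C \<union> D"] by blast
  ultimately have "independent (C \<union> D)"
    using card_eq_dim[of "C \<union> D" "U \<union> V"] C(2) D(2) fin by blast
  then obtain B where B: "C \<union> D \<subseteq> B" "independent B" "UNIV \<subseteq> span B"
    using maximal_independent_subset_extend[of "C \<union> D" UNIV] by auto
  have "W \<union> (C - W) \<union> (D - W) \<union> (B - (C \<union> D)) = B" "W \<union> (C - W) = C" "W \<union> (D - W) = D"
    using B(1) C(1) D(1) by auto
  moreover have "card B = dim UNIV"
    using B basis_card_eq_dim by blast
  ultimately show ?thesis
    using B(2) spC spD W(4) CD C(1) D(1)
    by (intro that[of W "C - W" "D - W" "B - (C \<union> D)"]) auto
qed

text \<open>Any two of \<open>x\<close>, \<open>f x\<close> and \<open>x + f x\<close> span the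
  third. This trades diagonal vectors for basis vectors, whose spans have known dimension.\<close>

lemma span_Un_sum_image:
  "span (A \<union> L \<union> (\<lambda>x. x + f x) ` L) = span (A \<union> L \<union> f ` L)"
  "span (A \<union> f ` L \<union> (\<lambda>x. x + f x) ` L) = span (A \<union> L \<union> f ` L)"
proof -
  have "x + f x \<in> span (A \<union> L \<union> f ` L)" if "x \<in> L" for x
    using that by (intro span_add span_base) auto
  moreover have "f x \<in> span (A \<union> L \<union> (\<lambda>x. x + f x) ` L)" if "x \<in> L" for x
    using that span_diff[of "x + f x" "A \<union> L \<union> (\<lambda>x. x + f x) ` L" x] by (simp add: span_base)
  moreover have "x \<in> span (A \<union> f ` L \<union> (\<lambda>x. x + f x) ` L)" if "x \<in> L" for x
    using that span_diff[of "x + f x" "A \<union> f ` L \<union> (\<lambda>x. x + f x) ` L" "f x"] by (simp add: span_base)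
  ultimately show "span (A \<union> L \<union> (\<lambda>x. x + f x) ` L) = span (A \<union> L \<union> f ` L)"
    "span (A \<union> f ` L \<union> (\<lambda>x. x + f x) ` L) = span (A \<union> L \<union> f ` L)"
    unfolding span_eq by (auto intro: span_base)
qed

text \<open>Take a basis adapted to \<open>U\<close> and \<open>V\<close>, and a bijection \<open>f\<close> from the part in \<open>U - V\<close> to the part in
  \<open>V - U\<close>. Then \<open>Z\<close> is spanned by \<open>p\<close> basis vectors of \<open>U \<inter> V\<close>, \<open>i\<close> in \<open>U - V\<close>, \<open>j\<close> in \<open>V - U\<close>, \<open>e\<close> outside
  both, and \<open>l\<close> diagonal vectors \<open>x + f x\<close>. Its intersections with \<open>U\<close> and \<open>V\<close> are computed from the
  sums \<open>U + Z\<close> and \<open>Z + V\<close>, which are spanned by basis vectors.\<close>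

lemma exists_subspace_dim_Int:
  assumes U: "subspace U" "dim U = k" and V: "subspace V" "dim V = k"
    and p: "p \<le> dim (U \<inter> V)" and il: "i + l + dim (U \<inter> V) \<le> k" and jl: "j + l + dim (U \<inter> V) \<le> k"
    and e: "e + 2 * k \<le> dim UNIV + dim (U \<inter> V)" and sum: "p + i + j + l + e = k"
  obtains Z where "subspace Z" "dim Z = k" "dim (U \<inter> Z) = p + i" "dim (Z \<inter> V) = p + j"
proof -
  obtain W X Y E where ind: "independent (W \<union> X \<union> Y \<union> E)"
    and disj: "W \<inter> X = {}" "W \<inter> Y = {}" "X \<inter> Y = {}" "(W \<union> X \<union> Y) \<inter> E = {}"
    and sp: "U = span (W \<union> X)" "V = span (W \<union> Y)"
    and cW: "card W = dim (U \<inter> V)" and cB: "card (W \<union> X \<union> Y \<union> E) = dim UNIV"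
    using exists_basis_adapted_to_pair[OF U(1) V(1)] by metis
  have fin: "finite W" "finite X" "finite Y" "finite E"
    using finiteI_independent[OF ind] by auto
  have "independent (W \<union> X)" "independent (W \<union> Y)"
    using ind by (auto elim!: independent_mono)
  then have "card (W \<union> X) = k" "card (W \<union> Y) = k"
    using U(2) V(2) sp dim_span_eq_card_independent by auto
  then have cX: "dim (U \<inter> V) + card X = k" and cY: "dim (U \<inter> V) + card Y = k"
    using disj fin cW by (auto simp: card_Un_disjoint)
  have cE: "dim (U \<inter> V) + card X + card Y + card E = dim UNIV"
    using cB disj fin cW by (simp add: card_Un_disjoint Int_Un_distrib2)
  obtain f where f: "bij_betw f X Y"
    using finite_same_card_bij[of X Y] fin cX cY by auto
  \<comment> \<open>The hypotheses \<open>p\<close>, \<open>il\<close>, \<open>jl\<close> and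
    \<open>e\<close> say that \<open>W\<close>, \<open>X\<close>, \<open>Y\<close> and
    \<open>E\<close> have room for these choices; in particular \<open>E\<close> has
    \<open>dim UNIV + dim (U \<inter> V) - 2 * k\<close> elements.\<close>
  obtain W' where W': "W' \<subseteq> W" "card W' = p"
    using obtain_subset_with_card_n[of p W] p cW by auto
  obtain E' where E': "E' \<subseteq> E" "card E' = e"
    using obtain_subset_with_card_n[of e E] e cE cX cY by auto
  obtain L where L: "L \<subseteq> X" "card L = l"
    using obtain_subset_with_card_n[of l X] il cX by auto
  have injf: "inj_on f L"
    using f L(1) by (meson bij_betw_def inj_on_subset)
  define F where "F = f ` L"
  have fL: "F \<subseteq> Y" "card (F) = l"
    using f L injf by (auto simp: F_def bij_betw_def card_image)
  have finL: "finite L" "finite F"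
    using L(1) fL(1) fin finite_subset by blast+
  have "i \<le> card (X - L)"
    using il cX L finL by (simp add: card_Diff_subset)
  then obtain I where I: "I \<subseteq> X - L" "card I = i"
    by (rule obtain_subset_with_card_n) blast
  have "j \<le> card (Y - F)"
    using jl cY fL finL by (simp add: card_Diff_subset)
  then obtain J where J: "J \<subseteq> Y - F" "card J = j"
    by (rule obtain_subset_with_card_n) blast
  have fin': "finite W'" "finite E'" "finite I" "finite J"
    using W' E' I J fin by (auto intro: finite_subset)
  have disj': "W' \<inter> I = {}" "W' \<inter> J = {}" "I \<inter> J = {}" "W' \<inter> E' = {}" "I \<inter> E' = {}" "J \<inter> E' = {}"
    "W' \<inter> L = {}" "I \<inter> L = {}" "J \<inter> L = {}" "E' \<inter> L = {}"
    "W' \<inter> F = {}" "I \<inter> F = {}" "J \<inter> F = {}" "E' \<inter> F = {}" "L \<inter> F = {}"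
    "W \<inter> J = {}" "X \<inter> J = {}" "W \<inter> F = {}" "X \<inter> F = {}"
    "W \<inter> E' = {}" "X \<inter> E' = {}" "F \<inter> E' = {}"
    "W \<inter> I = {}" "Y \<inter> I = {}" "W \<inter> L = {}" "Y \<inter> L = {}" "Y \<inter> E' = {}" "L \<inter> E' = {}"
    using disj W'(1) I(1) J(1) E'(1) L(1) fL(1) by (auto; blast)+
  let ?g = "\<lambda>x. x + f x"
  define G where "G = W' \<union> I \<union> J \<union> E'"
  define Z where "Z = span (G \<union> ?g ` L)"
  have dim_card: "dim (span A) = card A" if "A \<subseteq> W \<union> X \<union> Y \<union> E" for A
    using independent_mono[OF ind that] dim_span_eq_card_independent by blast
  have cG: "card G = p + i + j + e"
    using W'(2) I(2) J(2) E'(2) fin' disj'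
    by (simp add: G_def card_Un_disjoint Int_Un_distrib2)
  have Zsub: "subspace Z"
    unfolding Z_def by simp
  have "dim Z \<le> card (G \<union> ?g ` L)"
    unfolding Z_def by (rule dim_le_card) (auto simp: G_def fin' finL)
  also have "\<dots> \<le> card G + card (?g ` L)"
    by (rule card_Un_le)
  also have "\<dots> \<le> k"
    using card_image_le[OF finL(1), of ?g] L(2) cG sum by linarith
  finally have Zle: "dim Z \<le> k" .
  \<comment> \<open>Lower bound for \<open>dim Z\<close>: adding the \<open>l\<close> vectors of
    \<open>L\<close> to \<open>Z\<close> yields a span of \<open>k + l\<close> basis
    vectors.\<close>
  have "k + l = card (G \<union> L \<union> F)"
  proof -
    have "card (G \<union> L \<union> F) = card G + card L + card (F)"
      using fin' finL disj' by (simp add: G_def card_Un_disjoint Int_Un_distrib2)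
    then show ?thesis
      using cG L fL sum by simp
  qed
  also have "\<dots> = dim (span (G \<union> L \<union> ?g ` L))"
    unfolding span_Un_sum_image unfolding F_def[symmetric] using W' I J E' L fL by (subst dim_card) (auto simp: G_def)
  also have "span (G \<union> L \<union> ?g ` L) = span (Z \<union> span L)"
    unfolding Z_def span_Un_span by (simp add: Un_ac)
  also have "dim (span (Z \<union> span L)) \<le> dim Z + dim (span L)"
    using dim_Un_add_dim_Int[OF Zsub, of "span L"] by simp
  also have "dim (span L) = l"
    using dim_card[of L] L by auto
  finally have Zdim: "dim Z = k"
    using Zle by simp
  \<comment> \<open>As \<open>L\<close> lies in \<open>U\<close>, the diagonal vectors contribute
    exactly \<open>F\<close> to the sum with \<open>U\<close>; symmetrically, they contribute
    \<open>L\<close> to the sum with \<open>V\<close>.\<close>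
  have "span (U \<union> Z) = span ((W \<union> X \<union> G) \<union> L \<union> ?g ` L)"
    unfolding Z_def sp span_Un_span using L(1) by (intro arg_cong[where f = span]) auto
  also have "\<dots> = span (W \<union> X \<union> J \<union> F \<union> E')"
    unfolding span_Un_sum_image unfolding F_def[symmetric] using L(1) W'(1) I(1) by (intro arg_cong[where f = span]) (auto simp: G_def)
  finally have "dim (U \<union> Z) = card (W \<union> X \<union> J \<union> F \<union> E')"
    using dim_card[of "W \<union> X \<union> J \<union> F \<union> E'"] fL J E' dim_span[of "U \<union> Z"] by auto
  also have "\<dots> = card W + card X + card J + card (F) + card E'"
    using disj(1) fin fin' finL disj' by (simp add: card_Un_disjoint Int_Un_distrib2)
  finally have "dim (U \<union> Z) = k + j + l + e"
    using cW cX J E' fL by simp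
  then have 1: "dim (U \<inter> Z) = p + i"
    using dim_Un_add_dim_Int[OF U(1) Zsub] U(2) Zdim sum by linarith
  have "span (Z \<union> V) = span ((W \<union> Y \<union> G) \<union> f ` L \<union> ?g ` L)"
    unfolding Z_def sp span_Un_span using fL(1) unfolding F_def by (intro arg_cong[where f = span]) auto
  also have "\<dots> = span (W \<union> Y \<union> I \<union> L \<union> E')"
    unfolding span_Un_sum_image unfolding F_def[symmetric] using fL(1) W'(1) J(1) by (intro arg_cong[where f = span]) (auto simp: G_def)
  finally have "dim (Z \<union> V) = card (W \<union> Y \<union> I \<union> L \<union> E')"
    using dim_card[of "W \<union> Y \<union> I \<union> L \<union> E'"] L I E' dim_span[of "Z \<union> V"] by auto
  also have "\<dots> = card W + card Y + card I + card L + card E'"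
    using disj(2) fin fin' finL disj' by (simp add: card_Un_disjoint Int_Un_distrib2)
  finally have "dim (Z \<union> V) = k + i + l + e"
    using cW cY I E' L by simp
  then have 2: "dim (Z \<inter> V) = p + j"
    using dim_Un_add_dim_Int[OF Zsub V(1)] V(2) Zdim sum by linarith
  show ?thesis
    using that Zsub Zdim 1 2 by blast
qed

lemma exists_pair_dim_Int:
  assumes "c \<le> k" "2 * k \<le> dim UNIV + c"
  obtains U V where "subspace U" "dim U = k" "subspace V" "dim V = k" "dim (U \<inter> V) = c"
proof -
  have "k \<le> card Basis"
    using assms by simp
  then obtain T where T: "T \<subseteq> Basis" "card T = k"
    by (rule obtain_subset_with_card_n) blast
  then have U: "subspace (span T)" "dim (span T) = k"
    using independent_mono[OF independent_Basis] dim_span_eq_card_independent by auto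
  \<comment> \<open>The construction is applied to the pair \<open>span T\<close>,
    \<open>span T\<close>: \<open>c\<close> basis vectors inside, \<open>k - c\<close>
    outside.\<close>
  obtain V where "subspace V" "dim V = k" "dim (span T \<inter> V) = c + 0"
    by (rule exists_subspace_dim_Int[OF U U, of c 0 0 0 "k - c"]) (use assms U(2) in auto)
  with U that show ?thesis
    by (metis add_0_right)
qed

end

section \<open>Distance and diameter in terms of walks\<close>

lemma graph_dist_le_iff:
  "graph_dist G u v \<le> enat m \<longleftrightarrow> (\<exists>p. pre_digraph.awalk G u p v \<and> length p \<le> m)"
proof -
  \<comment> \<open>An infimum lies strictly below a bound iff some member does, hence the strict
    form.\<close>
  have "graph_dist G u v \<le> enat m \<longleftrightarrow> graph_dist G u v < enat (Suc m)"
    by (cases "graph_dist G u v") auto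
  then show ?thesis
    by (simp add: graph_dist_def INF_less_iff less_Suc_eq_le)
qed

lemma graph_diameter_eqI:
  assumes "\<And>u v. u \<in> verts G \<Longrightarrow> v \<in> verts G \<Longrightarrow> \<exists>p. pre_digraph.awalk G u p v \<and> length p \<le> m"
    and "u \<in> verts G" "v \<in> verts G" "\<And>p. pre_digraph.awalk G u p v \<Longrightarrow> m \<le> length p"
  shows "graph_diameter G = enat m"
proof (rule antisym)
  show "graph_diameter G \<le> enat m"
    unfolding graph_diameter_def using assms(1) by (intro SUP_least) (simp add: graph_dist_le_iff)
  have "enat m \<le> graph_dist G u v"
    unfolding graph_dist_def using assms(4) by (intro INF_greatest) auto
  then show "enat m \<le> graph_diameter G"
    unfolding graph_diameter_def using assms(2,3) by (intro SUP_upper2)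
qed

section \<open>Walks in the Grassmann graph and bounds on their lengths\<close>

lemma pverts_gen_grassmann_graph [simp]: "pverts (gen_grassmann_graph S k) = k_subspaces k"
  by (simp add: gen_grassmann_graph_def)

lemma parcs_gen_grassmann_graph_iff:
  "(U, V) \<in> parcs (gen_grassmann_graph S k) \<longleftrightarrow>
    U \<in> k_subspaces k \<and> V \<in> k_subspaces k \<and> U \<noteq> V \<and> vec.dim (U \<inter> V) \<in> S"
  by (simp add: gen_grassmann_graph_def)

lemma arc_gen_grassmann_graphI:
  assumes "U \<in> k_subspaces k" "V \<in> k_subspaces k" "vec.dim (U \<inter> V) = s" "s \<in> S" "s < k"
  shows "(U, V) \<in> parcs (gen_grassmann_graph S k)"
  using assms by (auto simp: parcs_gen_grassmann_graph_iff k_subspaces_def)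

lemma awalk_gen_grassmann_graph_Nil_iff:
  fixes U V :: "('a::{field,finite} ^ 'n) set"
  shows "pre_digraph.awalk (gen_grassmann_graph S k) U [] V \<longleftrightarrow> U = V \<and> U \<in> k_subspaces k"
proof -
  interpret pair_graph "gen_grassmann_graph S k :: ('a ^ 'n) set pair_pre_digraph"
    by (rule pair_graph_gen_grassmann_graph)
  show ?thesis
    by (simp add: awalk_Nil_iff)
qed

lemma awalk_gen_grassmann_graph_Cons_iff:
  fixes U V :: "('a::{field,finite} ^ 'n) set"
  shows "pre_digraph.awalk (gen_grassmann_graph S k) U (a # p) V \<longleftrightarrow>
    a \<in> parcs (gen_grassmann_graph S k) \<and> U = fst a \<and>
    pre_digraph.awalk (gen_grassmann_graph S k) (snd a) p V"
proof -
  interpret pair_graph "gen_grassmann_graph S k :: ('a ^ 'n) set pair_pre_digraph"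
    by (rule pair_graph_gen_grassmann_graph)
  show ?thesis
    by (simp add: awalk_Cons_iff)
qed

lemmas awalk_gen_grassmann_graph_simps =
  awalk_gen_grassmann_graph_Nil_iff awalk_gen_grassmann_graph_Cons_iff

text \<open>By \<open>dim_Int_triangle\<close>, each arc of the walk changes the separation from
  \<open>V\<close> by at most \<open>k - s\<close>.\<close>

lemma awalk_gen_grassmann_graph_dim_Int:
  fixes U V :: "('a::{field,finite} ^ 'n) set"
  assumes "pre_digraph.awalk (gen_grassmann_graph S k) U p V"
    and "\<And>r. r \<in> S \<Longrightarrow> s \<le> r" and "s \<le> k"
  shows "k \<le> vec.dim (U \<inter> V) + length p * (k - s)"
  using assms(1)
proof (induction p arbitrary: U)
  case Nil
  then show ?case
    by (auto simp: awalk_gen_grassmann_graph_simps k_subspaces_def)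
next
  case (Cons a p)
  obtain Z where a: "a = (U, Z)" and arc: "(U, Z) \<in> parcs (gen_grassmann_graph S k)"
    and walk: "pre_digraph.awalk (gen_grassmann_graph S k) Z p V"
    using Cons.prems by (cases a) (auto simp: awalk_gen_grassmann_graph_simps)
  have "V \<in> k_subspaces k"
    using walk by (induction p arbitrary: Z) (auto simp: awalk_gen_grassmann_graph_simps)
  then have "vec.dim (U \<inter> Z) + vec.dim (Z \<inter> V) \<le> k + vec.dim (U \<inter> V)" "s \<le> vec.dim (U \<inter> Z)"
    using arc vec.dim_Int_triangle[of U Z V] assms(2)
    by (auto simp: parcs_gen_grassmann_graph_iff k_subspaces_def)
  then show ?case
    using Cons.IH[OF walk] \<open>s \<le> k\<close> by simp
qed

text \<open>The induction starts at 2, since separation at most \<open>k - s\<close> does not give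
  adjacency: the intersection dimension may exceed \<open>s\<close> and be outside
  \<open>S\<close>.\<close>

lemma exists_awalk_gen_grassmann_graph:
  fixes U V :: "('a::{field,finite} ^ 'n) set"
  assumes "s \<in> S" "s < k" "2 * k \<le> CARD('n)"
    and V: "V \<in> k_subspaces k" and "2 \<le> m"
    and "U \<in> k_subspaces k" "k \<le> vec.dim (U \<inter> V) + m * (k - s)"
  shows "\<exists>p. pre_digraph.awalk (gen_grassmann_graph S k) U p V \<and> length p \<le> m"
  using assms(5-)
proof (induction m arbitrary: U rule: nat_induct_at_least)
  case base
  let ?c = "vec.dim (U \<inter> V)"
  have UV: "vec.subspace U" "vec.dim U = k" "vec.subspace V" "vec.dim V = k"
    using base V by (auto simp: k_subspaces_def)
  have c: "?c \<le> k"
    using vec.dim_subset[of "U \<inter> V" U] UV by simp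
  obtain Z where Z: "vec.subspace Z" "vec.dim Z = k" "vec.dim (U \<inter> Z) = s" "vec.dim (Z \<inter> V) = s"
  proof (cases "s \<le> ?c")
    case True
    \<comment> \<open>\<open>Z\<close> takes \<open>s\<close> vectors of
      \<open>U \<inter> V\<close>, a full set of \<open>k - ?c\<close> diagonals, and
      \<open>?c - s\<close> vectors outside \<open>U + V\<close>, where
      \<open>2 * k \<le> CARD('n)\<close> leaves room.\<close>
    show ?thesis
      by (rule vec.exists_subspace_dim_Int[OF UV, of s 0 "k - ?c" 0 "?c - s"])
        (use True c assms that in \<open>auto simp: vec_dim_card simp del: vec.dim_UNIV\<close>)
  next
    case False
    \<comment> \<open>\<open>Z\<close> contains \<open>U \<inter> V\<close>, topped up by
      \<open>s - ?c\<close> vectors from each side. The rest are diagonals; their number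
      \<open>k + ?c - 2 * s\<close> is nonnegative because the separation is at most
      \<open>2 * (k - s)\<close>.\<close>
    show ?thesis
      by (rule vec.exists_subspace_dim_Int[OF UV, of ?c "s - ?c" "k + ?c - 2 * s" "s - ?c" 0])
        (use False c assms base that in \<open>auto simp: vec_dim_card simp del: vec.dim_UNIV\<close>)
  qed
  have "Z \<in> k_subspaces k"
    using Z by (simp add: k_subspaces_def)
  then have "pre_digraph.awalk (gen_grassmann_graph S k) U [(U, Z), (Z, V)] V"
    using base V Z assms
    by (auto simp: awalk_gen_grassmann_graph_simps intro!: arc_gen_grassmann_graphI)
  then show ?case
    by (intro exI conjI) auto
next
  case (Suc m)
  let ?c = "vec.dim (U \<inter> V)"
  show ?case
  proof (cases "k \<le> ?c + m * (k - s)")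
    case True
    then show ?thesis
      using Suc.IH[OF Suc.prems(1)] le_SucI by blast
  next
    case False
    have UV: "vec.subspace U" "vec.dim U = k" "vec.subspace V" "vec.dim V = k"
      using Suc.prems V by (auto simp: k_subspaces_def)
    have "1 * (k - s) \<le> m * (k - s)"
      using Suc.hyps by (intro mult_right_mono) auto
    then have c: "?c + (k - s) \<le> k"
      using False by linarith
    \<comment> \<open>Here \<open>?c\<close> is at most \<open>s\<close>. \<open>Z\<close> keeps
      \<open>U \<inter> V\<close>, adds \<open>s - ?c\<close> vectors of \<open>U\<close> and takes
      \<open>k - s\<close> new ones from \<open>V\<close>.\<close>
    obtain Z where Z: "vec.subspace Z" "vec.dim Z = k" "vec.dim (U \<inter> Z) = s"
      "vec.dim (Z \<inter> V) = ?c + (k - s)"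
      by (rule vec.exists_subspace_dim_Int[OF UV, of ?c "s - ?c" 0 "k - s" 0])
        (use c assms in \<open>auto simp: vec_dim_card simp del: vec.dim_UNIV\<close>)
    have Zk: "Z \<in> k_subspaces k"
      using Z by (simp add: k_subspaces_def)
    obtain p where "pre_digraph.awalk (gen_grassmann_graph S k) Z p V" "length p \<le> m"
      using Suc.IH[OF Zk] Suc.prems(2) Z(4) by auto
    then have "pre_digraph.awalk (gen_grassmann_graph S k) U ((U, Z) # p) V"
      "length ((U, Z) # p) \<le> Suc m"
      using Suc.prems Zk Z assms
      by (auto simp: awalk_gen_grassmann_graph_simps intro!: arc_gen_grassmann_graphI)
    then show ?thesis
      by blast
  qed
qed

section \<open>The value of the diameter\<close>

lemma nat_ceiling_divide_le_iff:
  assumes "0 < (b :: nat)"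
  shows "nat \<lceil>real a / real b\<rceil> \<le> m \<longleftrightarrow> a \<le> m * b"
proof -
  have "nat \<lceil>real a / real b\<rceil> \<le> m \<longleftrightarrow> real a / real b \<le> real m"
    by (simp add: nat_le_iff ceiling_le_iff)
  also have "\<dots> \<longleftrightarrow> real a \<le> real (m * b)"
    using assms by (simp add: divide_le_eq)
  finally show ?thesis
    by (simp only: of_nat_le_iff)
qed

theorem theorem3p2:
  fixes q n k s :: nat and S :: "nat set"
  assumes "primepow q" and "CARD('a::{field,finite}) = q"
    and "CARD('n::finite) = n"
    and "n > 0" and "k > 0" and "n \<ge> 2 * k"
    and "S \<subseteq> {0..<k}" and "S \<noteq> {}" and "S \<noteq> {0..<k}"
    and "s = Min S"
  shows "graph_diameter (gen_grassmann_graph S k :: ('a ^ 'n) set pair_pre_digraph) =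
    enat (if s = 0 then 2 else nat \<lceil>real k / (real k - real s)\<rceil>)"
proof -
  let ?G = "gen_grassmann_graph S k :: ('a ^ 'n) set pair_pre_digraph"
  define m where "m = (if s = 0 then 2 else nat \<lceil>real k / (real k - real s)\<rceil>)"
  have "finite S"
    using assms(7) finite_subset by blast
  then have s: "s \<in> S" "s < k" and min: "\<And>r. r \<in> S \<Longrightarrow> s \<le> r"
    using assms(7,8,10) by (auto simp: Min_in subset_iff)
  \<comment> \<open>For nonzero \<open>s\<close>, \<open>m\<close> is the least number of steps of
    size \<open>k - s\<close> that cover separation \<open>k\<close>.\<close>
  have m_le: "m \<le> l \<longleftrightarrow> k \<le> l * (k - s)" if "s \<noteq> 0" for l
    using that nat_ceiling_divide_le_iff[of "k - s" k l] s by (simp add: m_def of_nat_diff)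
  have "2 \<le> m"
    using m_le[of 1] s by (cases "s = 0") (simp add: m_def, linarith)
  have km: "k \<le> m * (k - s)"
    using m_le[of m] by (cases "s = 0") (auto simp: m_def)
  have exist: "\<exists>U\<in>k_subspaces k. \<exists>V\<in>k_subspaces k. vec.dim (U \<inter> V :: ('a ^ 'n) set) = c"
    if "c \<le> k" for c
    using that vec.exists_pair_dim_Int[of c k] assms(3,6)
    by (metis (mono_tags, lifting) k_subspaces_def mem_Collect_eq trans_le_add1 vec_dim_card)
  have "\<exists>U\<in>k_subspaces k. \<exists>V\<in>k_subspaces k. \<forall>p. pre_digraph.awalk ?G U p V \<longrightarrow> m \<le> length p"
  proof (cases "s = 0")
    case True
    \<comment> \<open>For \<open>s = 0\<close> the separation bound excludes only length 0. A
      dimension missing from \<open>S\<close> also excludes a single arc, while \<open>c < k\<close>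
      makes \<open>U\<close> and \<open>V\<close> distinct.\<close>
    obtain c where c: "c < k" "c \<notin> S"
      using assms(7,9) by (metis atLeast0LessThan lessThan_iff subsetI subset_antisym)
    then obtain U V :: "('a ^ 'n) set" where
      UV: "U \<in> k_subspaces k" "V \<in> k_subspaces k" "vec.dim (U \<inter> V) = c"
      using exist[of c] by auto
    have "2 \<le> length p" if p: "pre_digraph.awalk ?G U p V" for p
    proof (rule ccontr)
      assume "\<not> 2 \<le> length p"
      then consider "p = []" | a where "p = [a]"
        by (cases p; cases "tl p") auto
      then show False
        using p UV c
        by cases (auto simp: awalk_gen_grassmann_graph_simps parcs_gen_grassmann_graph_iff k_subspaces_def)
    qed
    then show ?thesis
      using UV True by (auto simp: m_def)
  next
    case False
    \<comment> \<open>Trivial intersection gives the largest separation \<open>k\<close>, so every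
      walk has length at least \<open>m\<close> by \<open>m_le\<close>.\<close>
    obtain U V :: "('a ^ 'n) set" where
      UV: "U \<in> k_subspaces k" "V \<in> k_subspaces k" "vec.dim (U \<inter> V) = 0"
      using exist[of 0] by auto
    have "m \<le> length p" if "pre_digraph.awalk ?G U p V" for p
      using awalk_gen_grassmann_graph_dim_Int[OF that min] UV(3) s m_le[OF False] by simp
    then show ?thesis
      using UV by blast
  qed
  then obtain U V where UV: "U \<in> k_subspaces k" "V \<in> k_subspaces k"
    "\<And>p. pre_digraph.awalk ?G U p V \<Longrightarrow> m \<le> length p"
    by blast
  have "graph_diameter ?G = enat m"
  proof (rule graph_diameter_eqI[of _ _ U V])
    fix X Y assume "X \<in> verts ?G" "Y \<in> verts ?G"
    then show "\<exists>p. pre_digraph.awalk ?G X p Y \<and> length p \<le> m"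
      using exists_awalk_gen_grassmann_graph[OF s, of Y m X] \<open>2 \<le> m\<close> km assms(3,6) by simp
  qed (use UV in auto)
  then show ?thesis
    by (simp only: m_def)
qed

end
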